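(* Let $X$ be a set and let $z\in X$. Denote $X^-=X\smallsetminus\{z\}$. Let $M=\bigoplus_{x\in X^-}\mathbb{Z}[t,t^{-1}]$, let $\{e_i;\ i\in X^-\}$ be a free basis of the $\mathbb{Z}[t,t^{-1}]$-module $M$ (indexed by $X^-$), and let $e_z=0\in M$. Let $F$ be the set $M\times X$ equipped with the operation $$(a,i)\ast(b,j)=\big((1-t)\cdot a+t\cdot b+e_i-e_j,\ j\big).$$ Then $(F,\ast)$ is a free medial quandle over $\{(0,i);\ i\in X\}$.
   Context: A quandle is a set $Q$ with a binary operation $\ast$ such that, for all $x,y,z\in Q$: $x\ast(y\ast z)=(x\ast y)\ast(x\ast z)$; the equation $x\ast u=y$ has a unique solution $u\in Q$, denoted $x\backslash y$; and $x\ast x=x$. It is medial if $(x\ast y)\ast(u\ast v)=(x\ast u)\ast(y\ast v)$ for all $x,y,u,v\in Q$. With the operations $\ast,\backslash$ medial quandles form a variety. A medial quandle $F$ is free over a subset $Y\subset F$ if $Y$ generates $F$ (under $\ast$ and $\backslash$) and every map from $Y$ to a medial quandle extends to a (then unique) quandle homomorphism from $F$. *)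

theory Defs
  imports Complex_Main "HOL-Library.Poly_Mapping"
begin

section \<open>Medial quandles\<close>

locale quandle =
  fixes Q :: "'a set" and opr :: "'a \<Rightarrow> 'a \<Rightarrow> 'a" (infixl "\<star>" 70)
  assumes closed: "x \<in> Q \<Longrightarrow> y \<in> Q \<Longrightarrow> x \<star> y \<in> Q"
    and left_distrib: "x \<in> Q \<Longrightarrow> y \<in> Q \<Longrightarrow> w \<in> Q \<Longrightarrow> x \<star> (y \<star> w) = (x \<star> y) \<star> (x \<star> w)"
    and unique_solution: "x \<in> Q \<Longrightarrow> y \<in> Q \<Longrightarrow> \<exists>!u. u \<in> Q \<and> x \<star> u = y"
    and idem: "x \<in> Q \<Longrightarrow> x \<star> x = x"

locale medial_quandle = quandle +
  assumes medial: "x \<in> Q \<Longrightarrow> y \<in> Q \<Longrightarrow> u \<in> Q \<Longrightarrow> v \<in> Q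
    \<Longrightarrow> (x \<star> y) \<star> (u \<star> v) = (x \<star> u) \<star> (y \<star> v)"

definition left_div :: "'a set \<Rightarrow> ('a \<Rightarrow> 'a \<Rightarrow> 'a) \<Rightarrow> 'a \<Rightarrow> 'a \<Rightarrow> 'a" where
  "left_div Q opr x y = (THE u. u \<in> Q \<and> opr x u = y)"

inductive_set generated_subquandle :: "'a set \<Rightarrow> ('a \<Rightarrow> 'a \<Rightarrow> 'a) \<Rightarrow> 'a set \<Rightarrow> 'a set"
  for Q :: "'a set" and opr :: "'a \<Rightarrow> 'a \<Rightarrow> 'a" and Y :: "'a set" where
  gen_base: "y \<in> Y \<Longrightarrow> y \<in> generated_subquandle Q opr Y"
| gen_op: "x \<in> generated_subquandle Q opr Y \<Longrightarrow> y \<in> generated_subquandle Q opr Y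
    \<Longrightarrow> opr x y \<in> generated_subquandle Q opr Y"
| gen_div: "x \<in> generated_subquandle Q opr Y \<Longrightarrow> y \<in> generated_subquandle Q opr Y
    \<Longrightarrow> left_div Q opr x y \<in> generated_subquandle Q opr Y"

definition quandle_hom ::
  "'a set \<Rightarrow> ('a \<Rightarrow> 'a \<Rightarrow> 'a) \<Rightarrow> 'b set \<Rightarrow> ('b \<Rightarrow> 'b \<Rightarrow> 'b) \<Rightarrow> ('a \<Rightarrow> 'b) \<Rightarrow> bool" where
  "quandle_hom Q opr Q' opr' h \<longleftrightarrow>
     (\<forall>x\<in>Q. h x \<in> Q') \<and> (\<forall>x\<in>Q. \<forall>y\<in>Q. h (opr x y) = opr' (h x) (h y))"

text \<open>A definition cannot quantify over all types, so the element type of the target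
  quandles is a parameter. A theorem about \<open>TYPE('b)\<close> with \<open>'b\<close> free covers targets of
  every type.\<close>

definition free_medial_quandle_over ::
  "'b itself \<Rightarrow> 'a set \<Rightarrow> ('a \<Rightarrow> 'a \<Rightarrow> 'a) \<Rightarrow> 'a set \<Rightarrow> bool" where
  "free_medial_quandle_over (_ :: 'b itself) F opr Y \<longleftrightarrow>
     medial_quandle F opr \<and> Y \<subseteq> F \<and> generated_subquandle F opr Y = F \<and>
     (\<forall>(Q :: 'b set) opr' f. medial_quandle Q opr' \<and> (\<forall>y\<in>Y. f y \<in> Q) \<longrightarrow>
        (\<exists>h. quandle_hom F opr Q opr' h \<and> (\<forall>y\<in>Y. h y = f y)))"

context quandle
begin

lemma left_div: "x \<in> Q \<Longrightarrow> y \<in> Q \<Longrightarrow> left_div Q opr x y \<in> Q \<and> x \<star> left_div Q opr x y = y"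
  unfolding left_div_def by (rule theI'[OF unique_solution])

lemma left_div_eqI: "x \<in> Q \<Longrightarrow> u \<in> Q \<Longrightarrow> x \<star> u = y \<Longrightarrow> left_div Q opr x y = u"
  using closed left_div unique_solution by metis

lemma generated_subset: "Y \<subseteq> Q \<Longrightarrow> generated_subquandle Q opr Y \<subseteq> Q"
proof
  fix x assume "Y \<subseteq> Q" "x \<in> generated_subquandle Q opr Y"
  from this(2,1) show "x \<in> Q"
    by (induction rule: generated_subquandle.induct) (auto simp: closed left_div)
qed

end

lemma quandle_hom_left_div:
  assumes "quandle Q opr" "quandle Q' opr'" "quandle_hom Q opr Q' opr' h" "x \<in> Q" "y \<in> Q"
  shows "h (left_div Q opr x y) = left_div Q' opr' (h x) (h y)"
proof -
  note l = quandle.left_div[OF assms(1,4,5)]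
  have "opr' (h x) (h (left_div Q opr x y)) = h y"
    using assms(3,4) l unfolding quandle_hom_def by metis
  moreover have "h x \<in> Q'" "h (left_div Q opr x y) \<in> Q'"
    using assms(3,4) l unfolding quandle_hom_def by auto
  ultimately show ?thesis
    using quandle.left_div_eqI[OF assms(2)] by metis
qed

text \<open>The extension in the universal property is automatically unique.\<close>

lemma quandle_hom_unique:
  assumes "quandle F opr" "quandle Q' opr'" "Y \<subseteq> F" "generated_subquandle F opr Y = F"
    and h: "quandle_hom F opr Q' opr' h" and k: "quandle_hom F opr Q' opr' k"
    and eq: "\<And>y. y \<in> Y \<Longrightarrow> h y = k y" and "x \<in> F"
  shows "h x = k x"
proof -
  have "x \<in> generated_subquandle F opr Y" using assms by simp
  then show ?thesis
  proof (induction rule: generated_subquandle.induct)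
    case (gen_base y)
    then show ?case by (rule eq)
  next
    case (gen_op x y)
    then show ?case using h k assms(4) unfolding quandle_hom_def by metis
  next
    case (gen_div x y)
    then have "x \<in> F" "y \<in> F" using assms(4) by auto
    then show ?case
      using gen_div.IH quandle_hom_left_div[OF assms(1,2) h] quandle_hom_left_div[OF assms(1,2) k]
      by metis
  qed
qed

section \<open>Laurent polynomials and free modules over them\<close>

text \<open>Finitely supported functions \<open>int \<Rightarrow> int\<close> with the convolution product: the function
  \<open>p\<close> stands for the sum of all \<open>p n * t ^ n\<close>, so the type is the ring
  \<open>Z[t, t\<^sup>-\<^sup>1]\<close>.\<close>

type_synonym laurent = "int \<Rightarrow>\<^sub>0 int"

definition tt :: laurent where "tt = Poly_Mapping.single 1 1"

lemma tt_invertible: "tt * Poly_Mapping.single (- 1) 1 = 1"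
  by (simp add: tt_def mult_single)

definition lscale :: "laurent \<Rightarrow> ('i \<Rightarrow>\<^sub>0 laurent) \<Rightarrow> ('i \<Rightarrow>\<^sub>0 laurent)" where
  "lscale c m = Poly_Mapping.map ((*) c) m"

lemma lookup_lscale: "Poly_Mapping.lookup (lscale c m) i = c * Poly_Mapping.lookup m i"
  by (simp add: lscale_def Poly_Mapping.map.rep_eq when_def)

interpretation laurent_module: module "lscale :: laurent \<Rightarrow> ('i \<Rightarrow>\<^sub>0 laurent) \<Rightarrow> _"
  by unfold_locales
    (auto intro!: poly_mapping_eqI simp: lookup_lscale lookup_add algebra_simps)

text \<open>The direct sum of copies of \<open>Z[t, t\<^sup>-\<^sup>1]\<close> indexed by \<open>I\<close>.\<close>

definition direct_sum :: "'i set \<Rightarrow> ('i \<Rightarrow>\<^sub>0 laurent) set" where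
  "direct_sum I = {m. Poly_Mapping.keys m \<subseteq> I}"

definition free_basis :: "('j \<Rightarrow> ('i \<Rightarrow>\<^sub>0 laurent)) \<Rightarrow> 'j set \<Rightarrow> ('i \<Rightarrow>\<^sub>0 laurent) set \<Rightarrow> bool" where
  "free_basis e J M \<longleftrightarrow>
     inj_on e J \<and> \<not> module.dependent lscale (e ` J) \<and> module.span lscale (e ` J) = M"

lemma standard_free_basis: "free_basis (\<lambda>i. Poly_Mapping.single i 1) I (direct_sum I)"
proof -
  let ?b = "\<lambda>i. Poly_Mapping.single i (1 :: laurent)"
  have inj: "inj_on ?b J" for J :: "'a set"
    by (rule inj_onI) (metis keys_single one_neq_zero singleton_inject)
  have coeff: "Poly_Mapping.lookup (\<Sum>i\<in>J. lscale (c i) (?b i)) k = (if k \<in> J then c k else 0)"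
    if "finite J" for J c and k :: 'a
    using that by (simp add: lookup_sum lookup_lscale lookup_single when_def if_distrib cong: if_cong)
  have "\<not> laurent_module.dependent (?b ` I)"
  proof
    assume "laurent_module.dependent (?b ` I)"
    then obtain T u v where T: "finite T" "T \<subseteq> ?b ` I" "(\<Sum>w\<in>T. lscale (u w) w) = 0"
        "v \<in> T" "u v \<noteq> 0"
      unfolding laurent_module.dependent_explicit by auto
    obtain J where J: "T = ?b ` J" using T(2) by (meson subset_imageE)
    then have finJ: "finite J" using T(1) finite_imageD inj by blast
    have "(\<Sum>i\<in>J. lscale (u (?b i)) (?b i)) = 0"
      using T(3) unfolding J by (simp add: sum.reindex[OF inj])
    moreover obtain k where "k \<in> J" "v = ?b k" using T(4) J by auto
    ultimately show False using coeff[OF finJ, of "\<lambda>i. u (?b i)" k] T(5) by simp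
  qed
  moreover have "laurent_module.span (?b ` I) = direct_sum I"
  proof
    have "laurent_module.subspace (direct_sum I)"
      by (rule laurent_module.subspaceI,
          auto simp: direct_sum_def lookup_lscale lookup_add subset_iff in_keys_iff)
        (metis add.left_neutral)
    moreover have "?b ` I \<subseteq> direct_sum I" by (auto simp: direct_sum_def)
    ultimately show "laurent_module.span (?b ` I) \<subseteq> direct_sum I"
      by (simp add: laurent_module.span_minimal)
    show "direct_sum I \<subseteq> laurent_module.span (?b ` I)"
    proof
      fix m assume m: "m \<in> direct_sum I"
      have "m = (\<Sum>i\<in>Poly_Mapping.keys m. lscale (Poly_Mapping.lookup m i) (?b i))"
        by (rule poly_mapping_eqI) (simp add: coeff in_keys_iff)
      also have "\<dots> \<in> laurent_module.span (?b ` I)"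
        using m by (intro laurent_module.span_sum laurent_module.span_scale
            laurent_module.span_base) (auto simp: direct_sum_def)
      finally show "m \<in> laurent_module.span (?b ` I)" .
    qed
  qed
  ultimately show ?thesis unfolding free_basis_def using inj by blast
qed

end

theory Submission
  imports Defs "HOL-Algebra.Bij" "HOL-Algebra.Free_Abelian_Groups"
begin

text \<open>Let \<open>L\<^sub>x\<close> be the left translation by \<open>x\<close> in a medial quandle \<open>Q\<close>, and fix \<open>z \<in> Q\<close>.
  Mediality says that the displacements \<open>L\<^sub>y L\<^sub>z\<^sup>-\<^sup>1\<close> commute, so they generate an abelian
  group \<open>D\<close>; conjugation by \<open>L\<^sub>z\<close> turns \<open>D\<close> into a \<open>Z[t, t\<^sup>-\<^sup>1]\<close>-module, and conjugation by
  any other \<open>L\<^sub>x\<close> acts on \<open>D\<close> in the same way. Given values \<open>f i\<close>, the module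
  homomorphism \<open>\<phi>\<close> from \<open>M\<close> to \<open>D\<close> with \<open>\<phi> (e\<^sub>i) = L\<^bsub>f i\<^esub> L\<^bsub>f z\<^esub>\<^sup>-\<^sup>1\<close> gives the extension
  \<open>(a, i) \<mapsto> \<phi> a (f i)\<close>. The elements \<open>(0, i)\<close> generate because \<open>L\<^bsub>(0, i)\<^esub> L\<^bsub>(0, z)\<^esub>\<^sup>-\<^sup>1\<close> adds \<open>e\<^sub>i\<close>
  to the first component, while \<open>L\<^bsub>(0, j)\<^esub>\<close> multiplies by \<open>t\<close> in the fibre over \<open>j\<close>.\<close>

section \<open>Laurent modules as abelian groups\<close>

lemma lscale_simps:
  "lscale (c + d) m = lscale c m + lscale d m"
  "lscale (c - d) m = lscale c m - lscale d m"
  "lscale c (m + n) = lscale c m + lscale c n"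
  "lscale c (m - n) = lscale c m - lscale c n"
  "lscale c (lscale d m) = lscale (c * d) m"
  "lscale 1 m = m" "lscale c 0 = 0" "lscale 0 m = 0"
  by (auto intro!: poly_mapping_eqI simp: lookup_lscale lookup_add lookup_minus algebra_simps)

text \<open>As an abelian group the span is generated by the elements \<open>t^k b\<close>, because
  every Laurent polynomial is an integer combination of powers of t. A property stable under
  subtraction thus has to be checked only on these.\<close>

lemma laurent_span_induct [consumes 1, case_names zero diff base]:
  assumes "m \<in> laurent_module.span B"
    and zero: "P 0"
    and diff: "\<And>x y. x \<in> laurent_module.span B \<Longrightarrow> y \<in> laurent_module.span B \<Longrightarrow>
      P x \<Longrightarrow> P y \<Longrightarrow> P (x - y)"
    and base: "\<And>k b. b \<in> B \<Longrightarrow> P (lscale (Poly_Mapping.single k 1) b)"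
  shows "P m"
proof -
  let ?S = "laurent_module.span B"
  have mem: "lscale c b \<in> ?S" if "b \<in> B" for c b
    using that by (simp add: laurent_module.span_scale laurent_module.span_base)
  \<comment> \<open>\<open>laurent\<close> is also the type of formal integer combinations of
    exponents, so \<open>frag_induction\<close> builds the coefficient from monomials by
    subtraction.\<close>
  have scaled: "P (lscale c b)" if "b \<in> B" for c b
    using subset_UNIV[of "Poly_Mapping.keys c"]
  proof (induction c rule: frag_induction)
    case zero
    then show ?case using assms(2) by (simp add: lscale_simps)
  next
    case (one x)
    then show ?case using base that by simp
  next
    case (diff a c)
    then show ?case
      by (simp add: lscale_simps assms(3) mem that)
  qed
  have add: "P (x + y)" if "x \<in> ?S" "y \<in> ?S" "P x" "P y" for x y
    using diff[of x "0 - y"] diff[of 0 y] that zero laurent_module.span_zero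
      laurent_module.span_neg by fastforce
  have "m \<in> ?S \<and> P m"
    using assms(1)
  proof (induction rule: laurent_module.span_induct_alt)
    case base
    then show ?case by (simp add: zero laurent_module.span_zero)
  next
    case (step c x y)
    then show ?case
      by (simp add: add scaled mem laurent_module.span_add)
  qed
  then show ?thesis ..
qed

text \<open>A free module over \<open>Z[t, t\<^sup>-\<^sup>1]\<close> with basis \<open>B\<close> is a free abelian group on the
  elements \<open>t\<^sup>k b\<close>.\<close>

lemma (in comm_group) laurent_module_hom_exists:
  fixes B :: "('i \<Rightarrow>\<^sub>0 laurent) set"
  assumes B: "\<not> laurent_module.dependent B"
    and g: "\<And>b k. b \<in> B \<Longrightarrow> g b k \<in> carrier G"
  obtains \<phi> where "\<And>m. m \<in> laurent_module.span B \<Longrightarrow> \<phi> m \<in> carrier G"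
    "\<And>m n. m \<in> laurent_module.span B \<Longrightarrow> n \<in> laurent_module.span B \<Longrightarrow> \<phi> (m + n) = \<phi> m \<otimes> \<phi> n"
    "\<And>b k. b \<in> B \<Longrightarrow> \<phi> (lscale (Poly_Mapping.single k 1) b) = g b k"
proof -
  let ?R = "laurent_module.representation B"
  \<comment> \<open>The additive group of the ring is free abelian on the exponents, so each basis
    vector b gets its own homomorphism.\<close>
  have "\<exists>h. h \<in> hom (free_Abelian_group UNIV) G \<and> (\<forall>k. h (Poly_Mapping.single k 1) = g b k)"
    if "b \<in> B" for b
  proof -
    have "g b ` UNIV \<subseteq> carrier G" using g that by auto
    from free_Abelian_group_universal[OF this] show ?thesis by (metis UNIV_I)
  qed
  then obtain h where h: "\<And>b. b \<in> B \<Longrightarrow> h b \<in> hom (free_Abelian_group UNIV) G"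
      and hg: "\<And>b k. b \<in> B \<Longrightarrow> h b (Poly_Mapping.single k 1) = g b k"
    by metis
  have h_closed: "h b c \<in> carrier G" if "b \<in> B" for b c
    using hom_in_carrier[OF h[OF that], of c] by simp
  have h_add: "h b (c + d) = h b c \<otimes> h b d" if "b \<in> B" for b c d
    using hom_mult[OF h[OF that], of c d] by simp
  have h_zero: "h b 0 = \<one>" if "b \<in> B" for b
    using hom_one[OF h[OF that] group_free_Abelian_group is_group] by simp
  \<comment> \<open>Apply \<open>h b\<close> to the b-coordinate and multiply over all b. The basis
    may be infinite: only finitely many coordinates are nonzero, and \<open>h b 0\<close> is the
    unit.\<close>
  define \<phi> where "\<phi> m = gfinprod G (\<lambda>b. h b (?R m b)) B" for m
  show thesis
  proof
    show "\<phi> m \<in> carrier G" for m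
      unfolding \<phi>_def by (rule gfinprod_closed) (auto simp: h_closed)
    have fin: "finite {b \<in> B. h b (?R m b) \<noteq> \<one>}" for m
      by (rule finite_subset[OF _ laurent_module.finite_representation[of B m]])
        (use h_zero in force)
    show "\<phi> (m + n) = \<phi> m \<otimes> \<phi> n"
      if "m \<in> laurent_module.span B" "n \<in> laurent_module.span B" for m n
    proof -
      have "\<phi> (m + n) = gfinprod G (\<lambda>b. h b (?R m b) \<otimes> h b (?R n b)) B"
        unfolding \<phi>_def
        by (rule gfinprod_cong)
          (auto simp: h_closed h_add simp_implies_def laurent_module.representation_add[OF B that(2,1)])
      also have "\<dots> = \<phi> m \<otimes> \<phi> n"
        unfolding \<phi>_def by (rule gfinprod_distrib[OF fin fin]) (auto simp: h_closed)
      finally show ?thesis .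
    qed
    show "\<phi> (lscale (Poly_Mapping.single k 1) b) = g b k" if b: "b \<in> B" for b k
    proof -
      have R: "?R (lscale (Poly_Mapping.single k 1) b) c = (if c = b then Poly_Mapping.single k 1 else 0)" for c
        by (simp add: laurent_module.representation_scale[OF B laurent_module.span_base[OF b]]
            laurent_module.representation_basis[OF B b])
      have "\<phi> (lscale (Poly_Mapping.single k 1) b) = gfinprod G (\<lambda>c. g c k) {b}"
        unfolding \<phi>_def
        by (rule gfinprod_mono_neutral_cong_right) (use b in \<open>auto simp: R hg h_zero h_closed g\<close>)
      also have "\<dots> = g b k"
        using g[OF b] b by (subst gfinprod_eq_finprod) auto
      finally show ?thesis .
    qed
  qed
qed

section \<open>The displacement group of a medial quandle\<close>

text \<open>The centralizer of a is a subgroup.\<close>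

lemma (in group) generate_commute:
  assumes "S \<subseteq> carrier G" "a \<in> carrier G" "\<And>s. s \<in> S \<Longrightarrow> a \<otimes> s = s \<otimes> a"
    and "x \<in> generate G S"
  shows "a \<otimes> x = x \<otimes> a"
  using assms(4)
proof (induction rule: generate.induct)
  case (inv s)
  then have "s \<in> carrier G" "a \<otimes> s = s \<otimes> a" using assms by auto
  then show ?case
    by (metis assms(2) inv_closed inv_solve_left' inv_solve_right' m_assoc m_closed)
next
  case (eng x y)
  then show ?case
    by (metis assms(1,2) generate_in_carrier m_assoc)
qed (use assms in auto)

lemma (in group) comm_group_subgroup_generated:
  assumes "S \<subseteq> carrier G" "\<And>s t. s \<in> S \<Longrightarrow> t \<in> S \<Longrightarrow> s \<otimes> t = t \<otimes> s"
  shows "comm_group (subgroup_generated G S)"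
proof (rule group.group_comm_groupI[OF group_subgroup_generated])
  fix x y
  assume "x \<in> carrier (subgroup_generated G S)" "y \<in> carrier (subgroup_generated G S)"
  then have x: "x \<in> generate G S" and y: "y \<in> generate G S"
    using assms(1) by (simp_all add: carrier_subgroup_generated Int_absorb1)
  \<comment> \<open>Two passes: first every generator commutes with x, then x commutes with
    everything generated, in particular with y.\<close>
  have "s \<otimes> x = x \<otimes> s" if "s \<in> S" for s
    using generate_commute[OF assms(1) _ _ x, of s] that assms by auto
  then have "x \<otimes> y = y \<otimes> x"
    using generate_commute[OF assms(1) _ _ y, of x] x generate_in_carrier[OF assms(1)] by auto
  then show "x \<otimes>\<^bsub>subgroup_generated G S\<^esub> y = y \<otimes>\<^bsub>subgroup_generated G S\<^esub> x" by simp
qed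

section \<open>Permutations, left translations and automorphisms of a quandle\<close>

lemma BijGroup_simps:
  "carrier (BijGroup S) = Bij S"
  "\<alpha> \<in> Bij S \<Longrightarrow> \<beta> \<in> Bij S \<Longrightarrow> x \<in> S \<Longrightarrow> (\<alpha> \<otimes>\<^bsub>BijGroup S\<^esub> \<beta>) x = \<alpha> (\<beta> x)"
  "x \<in> S \<Longrightarrow> \<one>\<^bsub>BijGroup S\<^esub> x = x"
  by (auto simp: BijGroup_def compose_def)

lemma BijGroup_closed:
  "\<alpha> \<in> Bij S \<Longrightarrow> \<beta> \<in> Bij S \<Longrightarrow> \<alpha> \<otimes>\<^bsub>BijGroup S\<^esub> \<beta> \<in> Bij S"
  "\<alpha> \<in> Bij S \<Longrightarrow> inv\<^bsub>BijGroup S\<^esub> \<alpha> \<in> Bij S"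
  "\<one>\<^bsub>BijGroup S\<^esub> \<in> Bij S"
  by (simp_all add: BijGroup_def compose_Bij id_Bij)
    (metis BijGroup_def inv_BijGroup restrict_inv_into_Bij)

lemma Bij_mem: "\<alpha> \<in> Bij S \<Longrightarrow> x \<in> S \<Longrightarrow> \<alpha> x \<in> S"
  using Bij_imp_funcset by blast

lemma Bij_eqI: "\<alpha> \<in> Bij S \<Longrightarrow> \<beta> \<in> Bij S \<Longrightarrow> (\<And>x. x \<in> S \<Longrightarrow> \<alpha> x = \<beta> x) \<Longrightarrow> \<alpha> = \<beta>"
  by (meson Bij_imp_extensional extensionalityI)

context quandle
begin

abbreviation "BG \<equiv> BijGroup Q"

sublocale BG: group BG
  by (rule group_BijGroup)

text \<open>The restriction makes the map extensional, as elements of \<open>BijGroup Q\<close> must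
  be.\<close>

definition ltrans :: "'a \<Rightarrow> 'a \<Rightarrow> 'a" where
  "ltrans x = restrict ((\<star>) x) Q"

definition quandle_auts :: "('a \<Rightarrow> 'a) set" where
  "quandle_auts = {\<alpha> \<in> Bij Q. \<forall>x\<in>Q. \<forall>y\<in>Q. \<alpha> (x \<star> y) = \<alpha> x \<star> \<alpha> y}"

lemma ltrans_apply [simp]: "y \<in> Q \<Longrightarrow> ltrans x y = x \<star> y"
  by (simp add: ltrans_def)

lemma ltrans_Bij:
  assumes "x \<in> Q"
  shows "ltrans x \<in> Bij Q"
proof -
  have "bij_betw ((\<star>) x) Q Q"
    by (rule bij_betw_byWitness[where f' = "left_div Q (\<star>) x"])
      (auto simp: assms closed left_div left_div_eqI[OF assms _ refl])
  then show ?thesis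
    by (simp add: Bij_def ltrans_def)
qed

lemma ltrans_carrier: "x \<in> Q \<Longrightarrow> ltrans x \<in> carrier BG"
  by (simp add: ltrans_Bij BijGroup_simps(1))

lemma ltrans_aut: "x \<in> Q \<Longrightarrow> ltrans x \<in> quandle_auts"
  by (simp add: quandle_auts_def ltrans_Bij closed left_distrib[symmetric])

lemma subgroup_auts: "subgroup quandle_auts BG"
proof (rule BG.subgroupI)
  show "quandle_auts \<subseteq> carrier BG" by (auto simp: quandle_auts_def BijGroup_simps)
  have "\<one>\<^bsub>BG\<^esub> \<in> quandle_auts"
    by (simp add: quandle_auts_def BijGroup_simps BijGroup_closed closed)
  then show "quandle_auts \<noteq> {}" by auto
  show "inv\<^bsub>BG\<^esub> \<alpha> \<in> quandle_auts" if "\<alpha> \<in> quandle_auts" for \<alpha>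
    using that Bij_inv_into_lemma[of Q \<alpha> "(\<star>)"] BijGroup_closed(2)[of \<alpha> Q]
    by (auto simp: quandle_auts_def inv_BijGroup closed)
  show "\<alpha> \<otimes>\<^bsub>BG\<^esub> \<beta> \<in> quandle_auts" if "\<alpha> \<in> quandle_auts" "\<beta> \<in> quandle_auts" for \<alpha> \<beta>
    using that by (simp add: quandle_auts_def BijGroup_simps BijGroup_closed closed Bij_mem)
qed

text \<open>Evaluated at a point, this is the homomorphism law of \<alpha>. It is used as
  conjugation: \<alpha> carries L_x to the translation by \<open>\<alpha> x\<close>.\<close>

lemma aut_ltrans:
  assumes "\<alpha> \<in> quandle_auts" "x \<in> Q"
  shows "\<alpha> \<otimes>\<^bsub>BG\<^esub> ltrans x = ltrans (\<alpha> x) \<otimes>\<^bsub>BG\<^esub> \<alpha>"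
proof -
  have "\<alpha> \<in> Bij Q" using assms by (simp add: quandle_auts_def)
  then show ?thesis
    using assms by (intro Bij_eqI[of _ Q])
      (simp_all add: BijGroup_simps BijGroup_closed ltrans_Bij quandle_auts_def closed Bij_mem)
qed

definition displ :: "'a \<Rightarrow> 'a \<Rightarrow> 'a \<Rightarrow> 'a" where
  "displ z y = ltrans y \<otimes>\<^bsub>BG\<^esub> inv\<^bsub>BG\<^esub> ltrans z"

lemma displ_aut: "z \<in> Q \<Longrightarrow> y \<in> Q \<Longrightarrow> displ z y \<in> quandle_auts"
  unfolding displ_def
  by (simp add: ltrans_aut subgroup.m_closed[OF subgroup_auts] subgroup.m_inv_closed[OF subgroup_auts])

lemma displ_ltrans:
  assumes "z \<in> Q" "y \<in> Q"
  shows "displ z y \<otimes>\<^bsub>BG\<^esub> ltrans z = ltrans y"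
  using assms by (simp add: displ_def BG.m_assoc ltrans_carrier)

text \<open>Since L_z L_y L_z^-1 is the translation by \<open>z \<star> y\<close>, conjugation by
  L_z moves the displacement of y to that of \<open>z \<star> y\<close>. This is multiplication by t
  on generators.\<close>

lemma ltrans_displ:
  assumes "z \<in> Q" "y \<in> Q"
  shows "ltrans z \<otimes>\<^bsub>BG\<^esub> displ z y = displ z (z \<star> y) \<otimes>\<^bsub>BG\<^esub> ltrans z"
proof -
  note [simp] = ltrans_carrier assms closed
  have "ltrans z \<otimes>\<^bsub>BG\<^esub> ltrans y = ltrans (z \<star> y) \<otimes>\<^bsub>BG\<^esub> ltrans z"
    using aut_ltrans[OF ltrans_aut[OF assms(1)] assms(2)] by simp
  moreover have "ltrans z \<otimes>\<^bsub>BG\<^esub> displ z y = ltrans z \<otimes>\<^bsub>BG\<^esub> ltrans y \<otimes>\<^bsub>BG\<^esub> inv\<^bsub>BG\<^esub> ltrans z"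
    by (simp add: displ_def BG.m_assoc)
  ultimately show ?thesis
    using displ_ltrans[of z "z \<star> y"] by (simp add: BG.m_assoc)
qed

end

section \<open>Commuting displacements and their module structure\<close>

context medial_quandle
begin

lemma displ_commute:
  assumes "z \<in> Q" "x \<in> Q" "y \<in> Q"
  shows "displ z x \<otimes>\<^bsub>BG\<^esub> displ z y = displ z y \<otimes>\<^bsub>BG\<^esub> displ z x"
proof -
  note [simp] = ltrans_carrier assms closed
  note conj = aut_ltrans[OF ltrans_aut[OF assms(1)]]
  \<comment> \<open>Mediality in operator form.\<close>
  have "ltrans (z \<star> x) \<otimes>\<^bsub>BG\<^esub> ltrans y = ltrans (z \<star> y) \<otimes>\<^bsub>BG\<^esub> ltrans x"
    by (intro Bij_eqI[of _ Q]) (simp_all add: BijGroup_simps BijGroup_closed ltrans_Bij medial)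
  \<comment> \<open>After this substitution L_z cancels on the left, and multiplying by L_z^-1 on
    the right turns L_x and L_y into displacements.\<close>
  moreover have "ltrans (z \<star> u) = ltrans z \<otimes>\<^bsub>BG\<^esub> displ z u" if "u \<in> Q" for u
    using conj[OF that] that by (simp add: displ_def BG.inv_solve_right BG.m_assoc[symmetric])
  ultimately have "ltrans z \<otimes>\<^bsub>BG\<^esub> (displ z x \<otimes>\<^bsub>BG\<^esub> ltrans y) = ltrans z \<otimes>\<^bsub>BG\<^esub> (displ z y \<otimes>\<^bsub>BG\<^esub> ltrans x)"
    by (simp add: BG.m_assoc displ_def)
  then have "displ z x \<otimes>\<^bsub>BG\<^esub> ltrans y = displ z y \<otimes>\<^bsub>BG\<^esub> ltrans x"
    by (simp add: displ_def)
  then show ?thesis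
    by (simp add: displ_def BG.m_assoc[symmetric])
qed

text \<open>The base point only selects generators: L_x L_y^-1 is \<open>displ z x\<close> times the
  inverse of \<open>displ z y\<close>.\<close>

definition Dis :: "'a \<Rightarrow> ('a \<Rightarrow> 'a) monoid" where
  "Dis z = subgroup_generated BG (displ z ` Q)"

lemma displ_carrier: "z \<in> Q \<Longrightarrow> displ z ` Q \<subseteq> carrier BG"
  using displ_aut subgroup.subset[OF subgroup_auts] by blast

lemma comm_group_Dis: "z \<in> Q \<Longrightarrow> comm_group (Dis z)"
  unfolding Dis_def
  by (intro BG.comm_group_subgroup_generated displ_carrier) (auto simp: displ_commute)

lemma mult_Dis: "mult (Dis z) = mult BG"
  by (simp add: Dis_def)

lemma displ_Dis: "z \<in> Q \<Longrightarrow> y \<in> Q \<Longrightarrow> displ z y \<in> carrier (Dis z)"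
  unfolding Dis_def using BG.subgroup_generated_subset_carrier_subset[OF displ_carrier] by blast

lemma Dis_auts: "z \<in> Q \<Longrightarrow> carrier (Dis z) \<subseteq> quandle_auts"
  unfolding Dis_def
  by (intro BG.subgroup_generated_minimal subgroup_auts) (auto simp: displ_aut)

text \<open>Equivariance dictates the value on \<open>t^k b\<close>: conjugating
  \<open>displ z y\<close> by L_z^k gives the displacement of L_z^k y. Freeness as an abelian group
  turns these values into a homomorphism.\<close>

lemma Dis_module_exists:
  fixes B :: "('i \<Rightarrow>\<^sub>0 laurent) set"
  assumes z: "z \<in> Q" and B: "\<not> laurent_module.dependent B" and f: "\<And>b. b \<in> B \<Longrightarrow> f b \<in> Q"
  obtains \<phi> where "\<And>m. m \<in> laurent_module.span B \<Longrightarrow> \<phi> m \<in> carrier (Dis z)"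
    "\<And>m n. m \<in> laurent_module.span B \<Longrightarrow> n \<in> laurent_module.span B \<Longrightarrow>
      \<phi> (m + n) = \<phi> m \<otimes>\<^bsub>BG\<^esub> \<phi> n"
    "\<And>b. b \<in> B \<Longrightarrow> \<phi> b = displ z (f b)"
    "\<And>x m. x \<in> Q \<Longrightarrow> m \<in> laurent_module.span B \<Longrightarrow>
      ltrans x \<otimes>\<^bsub>BG\<^esub> \<phi> m = \<phi> (lscale tt m) \<otimes>\<^bsub>BG\<^esub> ltrans x"
proof -
  interpret D: comm_group "Dis z" by (rule comm_group_Dis[OF z])
  let ?S = "laurent_module.span B"
  let ?p = "\<lambda>k :: int. ltrans z [^]\<^bsub>BG\<^esub> k"
  note [simp] = z ltrans_carrier
  have p_mem: "?p k x \<in> Q" if "x \<in> Q" for k x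
    using BG.int_pow_closed[OF ltrans_carrier[OF z], of k] that
    by (auto simp: BijGroup_simps intro: Bij_mem)
  have p_Suc: "?p (1 + k) x = z \<star> ?p k x" if "x \<in> Q" for k x
    using that BG.int_pow_closed[OF ltrans_carrier[OF z], of k] p_mem
    by (simp add: BG.int_pow_mult[of "ltrans z"] BG.int_pow_1 BijGroup_simps ltrans_Bij)
  have gens: "displ z (?p k (f b)) \<in> carrier (Dis z)" if "b \<in> B" for b k
    using that by (simp add: displ_Dis p_mem f)
  obtain \<phi> where \<phi>_closed: "\<And>m. m \<in> ?S \<Longrightarrow> \<phi> m \<in> carrier (Dis z)"
    and add: "\<And>m n. m \<in> ?S \<Longrightarrow> n \<in> ?S \<Longrightarrow> \<phi> (m + n) = \<phi> m \<otimes>\<^bsub>BG\<^esub> \<phi> n"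
    and power: "\<And>b k. b \<in> B \<Longrightarrow> \<phi> (lscale (Poly_Mapping.single k 1) b) = displ z (?p k (f b))"
    by (rule D.laurent_module_hom_exists[OF B, where g = "\<lambda>b k. displ z (?p k (f b))", unfolded mult_Dis])
      (assumption | rule gens that)+
  have carr: "\<phi> m \<in> carrier BG" if "m \<in> ?S" for m
    using \<phi>_closed[OF that] Dis_auts[OF z] subgroup.subset[OF subgroup_auts] by blast
  \<comment> \<open>The claim is stable under differences, so the generators \<open>t^k b\<close>
    suffice; there it is \<open>ltrans_displ\<close>.\<close>
  have equiv: "ltrans z \<otimes>\<^bsub>BG\<^esub> \<phi> m = \<phi> (lscale tt m) \<otimes>\<^bsub>BG\<^esub> ltrans z" if "m \<in> ?S" for m
    using that
  proof (induction rule: laurent_span_induct)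
    case zero
    have "\<phi> 0 = \<one>\<^bsub>BG\<^esub>"
      using add[of 0 0] carr[of 0] by (simp add: laurent_module.span_zero BG.l_cancel_one)
    then show ?case by (simp add: lscale_simps)
  next
    case (diff x y)
    have t: "lscale tt x \<in> ?S" "lscale tt y \<in> ?S"
      using diff by (auto intro: laurent_module.span_scale)
    have m: "x - y \<in> ?S" "lscale tt (x - y) \<in> ?S"
      using diff by (auto intro: laurent_module.span_scale laurent_module.span_diff)
    note [simp] = carr diff.hyps t m
    \<comment> \<open>Writing x as (x - y) + y avoids inverses; the common factor
      \<open>\<phi> y\<close> cancels at the end.\<close>
    have x: "\<phi> x = \<phi> (x - y) \<otimes>\<^bsub>BG\<^esub> \<phi> y"
      using add[of "x - y" y] by simp
    have tx: "\<phi> (lscale tt x) = \<phi> (lscale tt (x - y)) \<otimes>\<^bsub>BG\<^esub> \<phi> (lscale tt y)"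
      using add[OF m(2) t(2)] by (simp add: lscale_simps)
    have "ltrans z \<otimes>\<^bsub>BG\<^esub> \<phi> (x - y) \<otimes>\<^bsub>BG\<^esub> \<phi> y = \<phi> (lscale tt x) \<otimes>\<^bsub>BG\<^esub> ltrans z"
      using diff.IH x by (simp add: BG.m_assoc)
    also have "\<dots> = \<phi> (lscale tt (x - y)) \<otimes>\<^bsub>BG\<^esub> ltrans z \<otimes>\<^bsub>BG\<^esub> \<phi> y"
      using diff.IH tx by (simp add: BG.m_assoc)
    finally show ?case
      by simp
  next
    case (base k b)
    have "lscale tt (lscale (Poly_Mapping.single k 1) b) = lscale (Poly_Mapping.single (1 + k) 1) b"
      by (simp add: lscale_simps tt_def mult_single)
    then show ?case
      using base by (simp add: power p_Suc f ltrans_displ p_mem)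
  qed
  show thesis
  proof
    show "\<phi> m \<in> carrier (Dis z)" if "m \<in> ?S" for m by (rule \<phi>_closed[OF that])
    show "\<phi> (m + n) = \<phi> m \<otimes>\<^bsub>BG\<^esub> \<phi> n" if "m \<in> ?S" "n \<in> ?S" for m n by (rule add[OF that])
    show "\<phi> b = displ z (f b)" if "b \<in> B" for b
      using power[OF that, of 0] that by (simp add: lscale_simps BijGroup_simps f)
    \<comment> \<open>L_x is \<open>displ z x\<close> times L_z, and \<open>displ z x\<close>
      commutes with \<open>\<phi> (lscale tt m)\<close> in the abelian group \<open>Dis z\<close>.
      So L_x conjugates in the same way as L_z.\<close>
    show "ltrans x \<otimes>\<^bsub>BG\<^esub> \<phi> m = \<phi> (lscale tt m) \<otimes>\<^bsub>BG\<^esub> ltrans x" if "x \<in> Q" "m \<in> ?S" for x m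
    proof -
      have tm: "lscale tt m \<in> ?S" using that by (simp add: laurent_module.span_scale)
      note [simp] = that carr tm
      have d: "displ z x \<in> carrier BG" using displ_carrier[OF z] that by auto
      have "ltrans x \<otimes>\<^bsub>BG\<^esub> \<phi> m = displ z x \<otimes>\<^bsub>BG\<^esub> \<phi> (lscale tt m) \<otimes>\<^bsub>BG\<^esub> ltrans z"
        using displ_ltrans[of z x] equiv[of m] d by (metis BG.m_assoc carr ltrans_carrier that tm z)
      also have "displ z x \<otimes>\<^bsub>BG\<^esub> \<phi> (lscale tt m) = \<phi> (lscale tt m) \<otimes>\<^bsub>BG\<^esub> displ z x"
        using D.m_comm[of "displ z x" "\<phi> (lscale tt m)"] by (simp add: mult_Dis displ_Dis \<phi>_closed)
      finally show ?thesis
        using displ_ltrans[of z x] d by (simp add: BG.m_assoc)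
    qed
  qed
qed

end

section \<open>The quandle structure on pairs\<close>

abbreviation affine_op :: "('j \<Rightarrow> ('i \<Rightarrow>\<^sub>0 laurent)) \<Rightarrow> ('i \<Rightarrow>\<^sub>0 laurent) \<times> 'j \<Rightarrow>
    ('i \<Rightarrow>\<^sub>0 laurent) \<times> 'j \<Rightarrow> ('i \<Rightarrow>\<^sub>0 laurent) \<times> 'j" where
  "affine_op e \<equiv> \<lambda>(a, i) (b, j). (lscale (1 - tt) a + lscale tt b + e i - e j, j)"

abbreviation tt_inv :: laurent where
  "tt_inv \<equiv> Poly_Mapping.single (- 1) 1"

lemma lscale_tt_inv: "lscale tt (lscale tt_inv m) = m" "lscale tt_inv (lscale tt m) = m"
  by (simp_all add: lscale_simps tt_invertible mult.commute[of tt_inv])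

text \<open>In the fibre over j a left translation is multiplication by t plus a constant, so unique
  solvability is invertibility of t. The other axioms are linear identities.\<close>

lemma medial_quandle_affine:
  assumes M: "laurent_module.subspace M" and e: "\<And>i. i \<in> X \<Longrightarrow> e i \<in> M"
  shows "medial_quandle (M \<times> X) (affine_op e)"
proof -
  note mem = laurent_module.subspace_add[OF M] laurent_module.subspace_diff[OF M]
    laurent_module.subspace_scale[OF M]
  show ?thesis
  proof (unfold_locales, goal_cases)
    case (1 x y)
    then show ?case by (auto intro!: mem e)
  next
    case (2 x y w)
    then show ?case
      by (auto intro!: poly_mapping_eqI simp: lookup_lscale lookup_add lookup_minus algebra_simps)
  next
    case (3 x y)
    obtain a i b j where xy: "x = (a, i)" "y = (b, j)" by fastforce
    let ?u = "(lscale tt_inv (b - lscale (1 - tt) a - e i + e j), j)"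
    show ?case
    proof (rule ex1I[of _ ?u])
      show "?u \<in> M \<times> X \<and> affine_op e x ?u = y"
        using 3 xy by (auto intro!: mem e simp: tt_invertible algebra_simps)
      show "u = ?u" if "u \<in> M \<times> X \<and> affine_op e x u = y" for u
      proof -
        obtain c k where u: "u = (c, k)" by fastforce
        then have "k = j" "lscale tt c = b - lscale (1 - tt) a - e i + e j"
          using that xy by (auto simp: algebra_simps)
        then show ?thesis using u lscale_tt_inv(2)[of c] by simp
      qed
    qed
  next
    case (4 x)
    then show ?case by (auto simp: lscale_simps)
  next
    case (5 x y u v)
    then show ?case
      by (auto intro!: poly_mapping_eqI simp: lookup_lscale lookup_add lookup_minus algebra_simps)
  qed
qed

section \<open>Generation by the elements (0, i)\<close>

lemma generated_affine:
  fixes e :: "'j \<Rightarrow> ('i \<Rightarrow>\<^sub>0 laurent)"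
  assumes e: "\<And>i. i \<in> X \<Longrightarrow> e i \<in> laurent_module.span (e ` (X - {z}))"
    and z: "z \<in> X" "e z = 0"
  shows "generated_subquandle (laurent_module.span (e ` (X - {z})) \<times> X) (affine_op e)
    {(0, i) | i. i \<in> X} = laurent_module.span (e ` (X - {z})) \<times> X"
proof -
  let ?M = "laurent_module.span (e ` (X - {z}))"
  let ?Y = "{(0 :: 'i \<Rightarrow>\<^sub>0 laurent, i) | i. i \<in> X}"
  interpret medial_quandle "?M \<times> X" "affine_op e"
    by (rule medial_quandle_affine[OF laurent_module.subspace_span e])
  let ?G = "generated_subquandle (?M \<times> X) (affine_op e) ?Y"
  have sub: "?G \<subseteq> ?M \<times> X"
    by (rule generated_subset) (auto simp: laurent_module.span_zero)
  have base: "(0, i) \<in> ?G" if "i \<in> X" for i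
    using that by (auto intro: generated_subquandle.gen_base)
  have up: "(lscale tt b + e i - e j, j) \<in> ?G" if "i \<in> X" "(b, j) \<in> ?G" for i b j
    using generated_subquandle.gen_op[OF base[OF that(1)] that(2)] by (simp add: lscale_simps)
  have down: "(lscale tt_inv (b - e i + e j), j) \<in> ?G" if "i \<in> X" "(b, j) \<in> ?G" for i b j
  proof -
    have "b \<in> ?M" "j \<in> X" using sub that(2) by auto
    then have "left_div (?M \<times> X) (affine_op e) (0, i) (b, j) = (lscale tt_inv (b - e i + e j), j)"
      using that(1)
      by (intro left_div_eqI) (auto simp: tt_invertible lscale_simps laurent_module.span_zero
          intro!: laurent_module.span_scale laurent_module.span_add laurent_module.span_diff e)
    then show ?thesis
      using generated_subquandle.gen_div[OF base[OF that(1)] that(2)] by simp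
  qed
  \<comment> \<open>Undo the translation by (0, z), then translate by (0, i): the factors t and the
    terms \<open>e j\<close> cancel. For \<open>minus\<close> the roles of i and z are
    exchanged.\<close>
  have plus: "(b + e i, j) \<in> ?G" if "i \<in> X" "(b, j) \<in> ?G" for i b j
    using up[OF that(1) down[OF z(1) that(2)]] z by (simp add: tt_invertible algebra_simps)
  have minus: "(b - e i, j) \<in> ?G" if "i \<in> X" "(b, j) \<in> ?G" for i b j
    using up[OF z(1) down[OF that]] z by (simp add: tt_invertible algebra_simps)
  \<comment> \<open>Translation by (0, j) within the fibre over j has no constant term, so it is
    pure multiplication by t.\<close>
  have snd_X: "j \<in> X" if "(b, j) \<in> ?G" for b j using subsetD[OF sub that] by simp
  have times: "(lscale tt b, j) \<in> ?G" if "(b, j) \<in> ?G" for b j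
    using up[OF snd_X[OF that] that] by simp
  have times_inv: "(lscale tt_inv b, j) \<in> ?G" if "(b, j) \<in> ?G" for b j
    using down[OF snd_X[OF that] that] by simp
  have powers: "(lscale (Poly_Mapping.single k 1) b, j) \<in> ?G" if "(b, j) \<in> ?G" for k b j
  proof (induction k rule: int_induct[of _ 0])
    case base
    then show ?case using that by (simp add: lscale_simps)
  next
    case (step1 k)
    then show ?case
      using times[OF step1(2)] by (simp add: lscale_simps tt_def mult_single add.commute)
  next
    case (step2 k)
    then show ?case
      using times_inv[OF step2(2)] by (simp add: lscale_simps mult_single add.commute)
  qed
  \<comment> \<open>Both signs are carried along because the difference case subtracts one summand
    and adds the other; b is quantified because it changes in every case.\<close>
  have shift: "\<forall>b j. (b, j) \<in> ?G \<longrightarrow> (b + m, j) \<in> ?G \<and> (b - m, j) \<in> ?G" if "m \<in> ?M" for m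
    using that
  proof (induction rule: laurent_span_induct)
    case (diff x y)
    show ?case
    proof (intro allI impI)
      fix b j assume "(b, j) \<in> ?G"
      then have "(b + x - y, j) \<in> ?G" "(b - x + y, j) \<in> ?G" using diff.IH by blast+
      then show "(b + (x - y), j) \<in> ?G \<and> (b - (x - y), j) \<in> ?G" by (simp add: algebra_simps)
    qed
  next
    case (base k v)
    then obtain i where i: "i \<in> X" "v = e i" by auto
    show ?case
    proof (intro allI impI)
      fix b j assume "(b, j) \<in> ?G"
      \<comment> \<open>To add \<open>t^k v\<close>, multiply by \<open>t^(-k)\<close>, add v, and
        multiply by \<open>t^k\<close>.\<close>
      from powers[OF this, of "- k"]
      have "(lscale (Poly_Mapping.single (- k) 1) b + v, j) \<in> ?G"
        "(lscale (Poly_Mapping.single (- k) 1) b - v, j) \<in> ?G"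
        using plus minus i by blast+
      from this[THEN powers[of _ _ k]]
      show "(b + lscale (Poly_Mapping.single k 1) v, j) \<in> ?G \<and>
          (b - lscale (Poly_Mapping.single k 1) v, j) \<in> ?G"
        by (simp add: lscale_simps mult_single)
    qed
  qed simp
  have "?M \<times> X \<subseteq> ?G"
  proof (rule subrelI)
    fix m j assume "(m, j) \<in> ?M \<times> X"
    then have "m \<in> ?M" "j \<in> X" by simp_all
    from shift[OF this(1), rule_format, OF base[OF this(2)]] show "(m, j) \<in> ?G" by simp
  qed
  with sub show ?thesis by (rule equalityI)
qed

section \<open>Extension of maps to homomorphisms\<close>

lemma (in medial_quandle) affine_hom_exists:
  assumes z: "z \<in> X" "e z = 0"
    and B: "inj_on e (X - {z})" "\<not> laurent_module.dependent (e ` (X - {z}))"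
    and f: "\<And>i. i \<in> X \<Longrightarrow> f i \<in> Q"
  obtains h where "quandle_hom (laurent_module.span (e ` (X - {z})) \<times> X) (affine_op e) Q (\<star>) h"
    "\<And>i. i \<in> X \<Longrightarrow> h (0, i) = f i"
proof -
  let ?M = "laurent_module.span (e ` (X - {z}))"
  have fz: "f z \<in> Q" using f z by simp
  interpret D: comm_group "Dis (f z)" by (rule comm_group_Dis[OF fz])
  \<comment> \<open>The module map is prescribed on basis vectors, so \<open>inv_into\<close>
    recovers their indices; this is where injectivity of e enters.\<close>
  have gens: "f (inv_into (X - {z}) e b) \<in> Q" if "b \<in> e ` (X - {z})" for b
    using inv_into_into[OF that] f by auto
  obtain \<phi> where D: "\<And>m. m \<in> ?M \<Longrightarrow> \<phi> m \<in> carrier (Dis (f z))"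
    and add: "\<And>m n. m \<in> ?M \<Longrightarrow> n \<in> ?M \<Longrightarrow> \<phi> (m + n) = \<phi> m \<otimes>\<^bsub>BG\<^esub> \<phi> n"
    and base: "\<And>b. b \<in> e ` (X - {z}) \<Longrightarrow> \<phi> b = displ (f z) (f (inv_into (X - {z}) e b))"
    and equiv: "\<And>x m. x \<in> Q \<Longrightarrow> m \<in> ?M \<Longrightarrow> ltrans x \<otimes>\<^bsub>BG\<^esub> \<phi> m = \<phi> (lscale tt m) \<otimes>\<^bsub>BG\<^esub> ltrans x"
    by (rule Dis_module_exists[OF fz B(2), where f = "\<lambda>b. f (inv_into (X - {z}) e b)"])
      (assumption | rule gens that)+
  have aut: "\<phi> m \<in> quandle_auts" if "m \<in> ?M" for m
    using D[OF that] Dis_auts[OF fz] by blast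
  have carr: "\<phi> m \<in> carrier BG" if "m \<in> ?M" for m
    using aut[OF that] subgroup.subset[OF subgroup_auts] by blast
  have comm: "\<phi> m \<otimes>\<^bsub>BG\<^esub> \<phi> n = \<phi> n \<otimes>\<^bsub>BG\<^esub> \<phi> m" if "m \<in> ?M" "n \<in> ?M" for m n
    using D.m_comm[OF D[OF that(1)] D[OF that(2)]] by (simp add: mult_Dis)
  have mem: "\<phi> m x \<in> Q" if "m \<in> ?M" "x \<in> Q" for m x
    using carr that by (simp add: BijGroup_simps Bij_mem)
  have zero: "\<phi> 0 = \<one>\<^bsub>BG\<^esub>"
    using add[of 0 0] carr[of 0] by (simp add: laurent_module.span_zero BG.l_cancel_one)
  have e: "e i \<in> ?M" if "i \<in> X" for i
    using that z by (cases "i = z") (auto simp: laurent_module.span_zero intro: laurent_module.span_base)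
  have \<phi>e: "\<phi> (e i) = displ (f z) (f i)" if "i \<in> X" for i
  proof (cases "i = z")
    \<comment> \<open>The displacement of the base point \<open>f z\<close> is trivial, matching
      \<open>e z = 0\<close>.\<close>
    case True
    then show ?thesis using zero z fz by (simp add: displ_def ltrans_carrier)
  next
    case False
    then show ?thesis using base[of "e i"] that B(1) by simp
  qed
  define h where "h = (\<lambda>(a, i). \<phi> a (f i))"
  have hom: "h (affine_op e (a, i) (b, j)) = h (a, i) \<star> h (b, j)"
    if "a \<in> ?M" "i \<in> X" "b \<in> ?M" "j \<in> X" for a i b j
  proof -
    define w where "w = lscale (1 - tt) a + lscale tt b + e i - e j"
    define L where "L = ltrans (\<phi> a (f i))"
    have ta: "lscale tt a \<in> ?M" and tb: "lscale tt b \<in> ?M" and w: "w \<in> ?M"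
      unfolding w_def using that e
      by (auto intro!: laurent_module.span_scale laurent_module.span_add laurent_module.span_diff)
    have L: "L \<in> carrier BG" unfolding L_def using that by (simp add: ltrans_carrier mem f)
    note [simp] = carr that ta tb w L e f ltrans_carrier fz
    have sums: "lscale tt a + e j \<in> ?M" "lscale tt b + e i \<in> ?M"
      by (simp_all add: laurent_module.span_add)
    \<comment> \<open>The defining equation of w is rearranged without minus signs, so that
      additivity of \<phi> applies directly.\<close>
    have "w + (lscale tt a + e j) = a + (lscale tt b + e i)"
      by (simp add: w_def lscale_simps)
    then have "\<phi> w \<otimes>\<^bsub>BG\<^esub> (\<phi> (lscale tt a) \<otimes>\<^bsub>BG\<^esub> \<phi> (e j)) =
        \<phi> a \<otimes>\<^bsub>BG\<^esub> (\<phi> (lscale tt b) \<otimes>\<^bsub>BG\<^esub> \<phi> (e i))"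
      using add sums by (metis that(1) ta tb w e that(2,4))
    then have "\<phi> w \<otimes>\<^bsub>BG\<^esub> (\<phi> (lscale tt a) \<otimes>\<^bsub>BG\<^esub> (\<phi> (e j) \<otimes>\<^bsub>BG\<^esub> ltrans (f z))) =
        \<phi> a \<otimes>\<^bsub>BG\<^esub> (\<phi> (lscale tt b) \<otimes>\<^bsub>BG\<^esub> (\<phi> (e i) \<otimes>\<^bsub>BG\<^esub> ltrans (f z)))"
      by (simp add: BG.m_assoc[symmetric])
    then have "\<phi> w \<otimes>\<^bsub>BG\<^esub> (\<phi> (lscale tt a) \<otimes>\<^bsub>BG\<^esub> ltrans (f j)) =
        \<phi> a \<otimes>\<^bsub>BG\<^esub> (\<phi> (lscale tt b) \<otimes>\<^bsub>BG\<^esub> ltrans (f i))"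
      by (simp add: \<phi>e displ_ltrans)
    \<comment> \<open>Equivariance moves \<open>\<phi> (lscale tt a)\<close> and
      \<open>\<phi> (lscale tt b)\<close> to the right past the translations, removing t.\<close>
    then have "\<phi> w \<otimes>\<^bsub>BG\<^esub> ltrans (f j) \<otimes>\<^bsub>BG\<^esub> \<phi> a = \<phi> a \<otimes>\<^bsub>BG\<^esub> ltrans (f i) \<otimes>\<^bsub>BG\<^esub> \<phi> b"
      by (simp add: equiv BG.m_assoc)
    \<comment> \<open>The automorphism \<open>\<phi> a\<close> conjugates the translation by
      \<open>f i\<close> to L, and then commutes with \<open>\<phi> b\<close>, so it can be
      cancelled.\<close>
    also have "\<dots> = L \<otimes>\<^bsub>BG\<^esub> \<phi> b \<otimes>\<^bsub>BG\<^esub> \<phi> a"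
      using aut_ltrans[OF aut, of a "f i"] comm[of a b] by (simp add: BG.m_assoc L_def[symmetric])
    finally have "\<phi> w \<otimes>\<^bsub>BG\<^esub> ltrans (f j) = L \<otimes>\<^bsub>BG\<^esub> \<phi> b"
      by simp
    \<comment> \<open>At \<open>f j\<close> the operator identity becomes the homomorphism law,
      since idempotence makes \<open>ltrans (f j)\<close> fix \<open>f j\<close>.\<close>
    then have "(\<phi> w \<otimes>\<^bsub>BG\<^esub> ltrans (f j)) (f j) = (L \<otimes>\<^bsub>BG\<^esub> \<phi> b) (f j)" by simp
    moreover have "\<phi> w \<in> Bij Q" "\<phi> b \<in> Bij Q" "L \<in> Bij Q"
      using carr[OF w] carr[of b] L by (simp_all add: BijGroup_simps(1))
    ultimately show ?thesis
      by (simp add: BijGroup_simps(2) ltrans_Bij idem h_def w_def[symmetric] L_def mem)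
  qed
  show thesis
  proof
    show "quandle_hom (?M \<times> X) (affine_op e) Q (\<star>) h"
      unfolding quandle_hom_def using hom by (auto simp: h_def mem f)
    show "h (0, i) = f i" if "i \<in> X" for i
      using that by (simp add: h_def zero BijGroup_simps f)
  qed
qed

theorem theorem3p3:
  fixes X :: "'x set" and z :: 'x
    and M :: "('x \<Rightarrow>\<^sub>0 laurent) set"
    and e :: "'x \<Rightarrow> ('x \<Rightarrow>\<^sub>0 laurent)"
  assumes "z \<in> X"
    and "M = direct_sum (X - {z})"
    and "free_basis e (X - {z}) M"
    and "e z = 0"
  shows "free_medial_quandle_over TYPE('q) (M \<times> X)
    (\<lambda>(a, i) (b, j). (lscale (1 - tt) a + lscale tt b + e i - e j, j))
    {(0, i) | i. i \<in> X}"
proof -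
  have inj: "inj_on e (X - {z})" and ind: "\<not> laurent_module.dependent (e ` (X - {z}))"
    and M: "M = laurent_module.span (e ` (X - {z}))"
    using assms(3) by (auto simp: free_basis_def)
  have e: "e i \<in> M" if "i \<in> X" for i
    using that assms(4) unfolding M
    by (cases "i = z") (auto simp: laurent_module.span_zero intro: laurent_module.span_base)
  have "\<exists>h. quandle_hom (M \<times> X) (affine_op e) Q opr h \<and> (\<forall>y\<in>{(0, i) | i. i \<in> X}. h y = f y)"
    if "medial_quandle Q opr" "\<forall>y\<in>{(0, i) | i. i \<in> X}. f y \<in> Q" for Q :: "'q set" and opr f
  proof -
    have "f (0, i) \<in> Q" if "i \<in> X" for i using \<open>\<forall>y\<in>_. f y \<in> Q\<close> that by auto
    obtain h where "quandle_hom (M \<times> X) (affine_op e) Q opr h" "\<And>i. i \<in> X \<Longrightarrow> h (0, i) = f (0, i)"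
      unfolding M
      by (rule medial_quandle.affine_hom_exists[OF \<open>medial_quandle Q opr\<close> assms(1,4) inj ind,
            where f = "\<lambda>i. f (0, i)"])
        (use \<open>\<And>i. i \<in> X \<Longrightarrow> f (0, i) \<in> Q\<close> in blast)+
    then show ?thesis by blast
  qed
  moreover have "medial_quandle (M \<times> X) (affine_op e)"
    unfolding M by (rule medial_quandle_affine[OF laurent_module.subspace_span e[unfolded M]])
  moreover have "generated_subquandle (M \<times> X) (affine_op e) {(0, i) | i. i \<in> X} = M \<times> X"
    unfolding M using generated_affine[OF e[unfolded M] assms(1,4)] .
  moreover have "{(0, i) | i. i \<in> X} \<subseteq> M \<times> X"
    unfolding M by (auto simp: laurent_module.span_zero)
  ultimately show ?thesis
    unfolding free_medial_quandle_over_def by blast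
qed

end
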